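(* Let $\mathcal X=\Delta^n$, let $F:\Delta^n\to\mathbb R^n$ be Lipschitz continuous and pseudo-monotone, let $\eta>0$, $\alpha=\frac1\eta$, $\beta=0$, $S=\nabla h$ with $h(x)=\sum_{i=1}^n x_i\log x_i$ the negative entropy, and let $$T(x)=\nabla h^*\big(\nabla h(x)+\eta[-\hat F(x)]_+^{\mathrm{nor}}\big)$$ for $x$ in the relative interior of $\Delta^n$. Then the dual update $$\dot z(t)=\alpha\big(S(T(x(t)))-S(x(t))\big),\qquad x(t)=\nabla h^*(z(t)),$$ reduces to the Brown–von Neumann–Nash (BNN) dynamics $$\dot x_i(t)=[-\hat F_i(x(t))]_+-x_i(t)\sum_{k=1}^n[-\hat F_k(x(t))]_+,\qquad i=1,\dots,n,$$ and $$T(x)=x\oplus\exp\big(\eta[-\hat F(x)]_+^{\mathrm{nor}}\big)\in\operatorname{int}(\Delta^n).$$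
   Context: $\Delta^n=\{x\in\mathbb R^n: x_i\ge0,\ \sum_i x_i=1\}$ is the probability simplex, and $\operatorname{int}(\Delta^n)$ denotes its relative interior (all entries positive). $x_i$ is the $i$-th entry of $x$. $F$ is pseudo-monotone if $F(y)^\top(x-y)\ge0\Rightarrow F(x)^\top(x-y)\ge0$ for all $x,y\in\Delta^n$. The map $\hat F$ is $\hat F(x)=F(x)-\bar F(x)\mathbf 1$ with $\bar F(x)=x^\top F(x)$ and $\mathbf 1$ the all-ones vector; $[\cdot]_+$ is the entrywise positive part; $[-\hat F(x)]_+^{\mathrm{nor}}$ is the vector with entries $[-\hat F_i(x)]_+/x_i$. $\exp$ and $\log$ act entrywise. $\nabla h(x)=\log x+\mathbf 1$ on positive vectors, $h^*(z)=\sup_{x\in\Delta^n}\{\langle z,x\rangle-h(x)\}$, and $\nabla h^*:\mathbb R^n\to\Delta^n$ is the mirror map. For $a,b\in\mathbb R^n_{>0}$, $a\oplus b\in\Delta^n$ has entries $(a\oplus b)_i=a_ib_i/\sum_k a_kb_k$. Standing assumption: there is $x^*\in\Delta^n$ with $F(x^* )^\top(x-x^* )\ge0$ for all $x\in\Delta^n$. *)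

theory Defs
  imports "HOL-Analysis.Analysis"
begin

definition prob_simplex :: "(real ^ 'n) set" where
  "prob_simplex = {x. (\<forall>i. 0 \<le> x $ i) \<and> (\<Sum>i\<in>UNIV. x $ i) = 1}"

definition pseudo_monotone_on :: "'a::real_inner set \<Rightarrow> ('a \<Rightarrow> 'a) \<Rightarrow> bool" where
  "pseudo_monotone_on X F \<longleftrightarrow>
     (\<forall>x\<in>X. \<forall>y\<in>X. F y \<bullet> (x - y) \<ge> 0 \<longrightarrow> F x \<bullet> (x - y) \<ge> 0)"

text \<open>Unspecified at points where \<open>f\<close> is not differentiable.\<close>

definition gradient :: "('a::real_inner \<Rightarrow> real) \<Rightarrow> 'a \<Rightarrow> 'a" where
  "gradient f x = (THE D. GDERIV f x :> D)"

text \<open>Since \<open>0 * ln 0 = 0\<close>, this is the usual continuous extension on the boundary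
  of the simplex.\<close>

definition neg_entropy :: "real ^ 'n \<Rightarrow> real" where
  "neg_entropy x = (\<Sum>i\<in>UNIV. x $ i * ln (x $ i))"

text \<open>A real-valued supremum: meaningful when the set of values is nonempty and bounded above,
  as it is for continuous \<open>h\<close> on a nonempty compact set \<open>X\<close>.\<close>

definition conjugate_on :: "'a::real_inner set \<Rightarrow> ('a \<Rightarrow> real) \<Rightarrow> 'a \<Rightarrow> real" where
  "conjugate_on X h z = (SUP x\<in>X. z \<bullet> x - h x)"

definition mirror_map :: "real ^ 'n \<Rightarrow> real ^ 'n" where
  "mirror_map = gradient (conjugate_on prob_simplex neg_entropy)"

definition Fhat :: "(real ^ 'n \<Rightarrow> real ^ 'n) \<Rightarrow> real ^ 'n \<Rightarrow> real ^ 'n" where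
  "Fhat F x = F x - (x \<bullet> F x) *\<^sub>R 1"

definition pos_part_vec :: "real ^ 'n \<Rightarrow> real ^ 'n" where
  "pos_part_vec v = (\<chi> i. max 0 (v $ i))"

definition normalized_excess :: "(real ^ 'n \<Rightarrow> real ^ 'n) \<Rightarrow> real ^ 'n \<Rightarrow> real ^ 'n" where
  "normalized_excess F x = (\<chi> i. pos_part_vec (- Fhat F x) $ i / x $ i)"

definition exp_vec :: "real ^ 'n \<Rightarrow> real ^ 'n" where
  "exp_vec v = (\<chi> i. exp (v $ i))"

definition simplex_plus :: "real ^ 'n \<Rightarrow> real ^ 'n \<Rightarrow> real ^ 'n"  (infixl "\<oplus>" 65) where
  "a \<oplus> b = (\<chi> i. a $ i * b $ i / (\<Sum>k\<in>UNIV. a $ k * b $ k))"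

definition bnn_field :: "(real ^ 'n \<Rightarrow> real ^ 'n) \<Rightarrow> real ^ 'n \<Rightarrow> real ^ 'n" where
  "bnn_field F x = (\<chi> i. pos_part_vec (- Fhat F x) $ i
     - x $ i * (\<Sum>k\<in>UNIV. pos_part_vec (- Fhat F x) $ k))"

end

theory Submission
  imports Defs
begin

text \<open>
  Gibbs' variational principle identifies the conjugate of the negative entropy on the simplex
  with the log-sum-exp function (\<open>conjugate_neg_entropy\<close>), so the mirror map is its gradient, the
  softmax map \<open>z \<mapsto> exp z / \<Sum> exp z\<close> (\<open>mirror_map_eq_softmax\<close>). Softmax ignores a common shift of
  all coordinates, and \<open>\<nabla>h x = log x + 1\<close> at positive \<open>x\<close>; hence
  \<open>mirror_map (\<nabla>h x + v) = x \<oplus> exp v\<close>, a vector with positive entries.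

  For the dynamics, let \<open>v = [-Fhat x]\<^sub>+/x\<close>. Taking logarithms of \<open>T x = x \<oplus> exp (\<eta> v)\<close> shows
  that the dual velocity \<open>(log (T x) - log x) / \<eta>\<close> equals \<open>v\<close> up to a multiple of the all-ones
  vector. Differentiating softmax along a curve gives the replicator form
  \<open>x\<^sub>i' = x\<^sub>i (z\<^sub>i' - \<Sum>\<^sub>k x\<^sub>k z\<^sub>k')\<close>, in which multiples of the all-ones vector cancel (this is
  the shift invariance again). Since \<open>x\<^sub>k v\<^sub>k\<close> is the \<open>k\<close>-th entry of \<open>[-Fhat x]\<^sub>+\<close>, what is left
  is the BNN field.
\<close>

section \<open>The relative interior of the simplex\<close>

lemma axis_in_prob_simplex: "axis i 1 \<in> prob_simplex"
  by (auto simp: prob_simplex_def axis_def)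

lemma convex_prob_simplex: "convex (prob_simplex :: (real ^ 'n) set)"
  unfolding convex_def prob_simplex_def
  by (auto simp: sum.distrib simp flip: sum_distrib_left)

text \<open>
  A point is relatively interior iff every segment of the simplex ending there can be prolonged
  a little. Prolonging a segment that starts at a vertex forces a positive coordinate; conversely
  the smallest coordinate of a positive point is a safe prolongation.
\<close>

lemma rel_interior_prob_simplex:
  "rel_interior (prob_simplex :: (real ^ 'n) set) = {x \<in> prob_simplex. \<forall>i. 0 < x $ i}"
proof (intro equalityI subsetI)
  fix x :: "real ^ 'n"
  assume x: "x \<in> rel_interior prob_simplex"
  have "0 < x $ i" for i
  proof -
    obtain e where e: "e > 1" "(1 - e) *\<^sub>R axis i 1 + e *\<^sub>R x \<in> prob_simplex"
      using x convex_rel_interior_iff[OF convex_prob_simplex] axis_in_prob_simplex by blast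
    have "0 \<le> ((1 - e) *\<^sub>R axis i 1 + e *\<^sub>R x) $ i"
      using e(2) unfolding prob_simplex_def by blast
    then have "0 < e * x $ i"
      using e(1) by (simp add: axis_def)
    then show ?thesis
      using e(1) by (simp add: zero_less_mult_iff)
  qed
  then show "x \<in> {x \<in> prob_simplex. \<forall>i. 0 < x $ i}"
    using x rel_interior_subset by blast
next
  fix x :: "real ^ 'n"
  assume "x \<in> {x \<in> prob_simplex. \<forall>i. 0 < x $ i}"
  then have x: "x \<in> prob_simplex" and pos: "\<And>i. 0 < x $ i" by auto
  define m where "m = Min (range (($) x))"
  have m: "0 < m" "m \<le> x $ i" for i
    using pos by (auto simp: m_def)
  have "\<exists>e>1. (1 - e) *\<^sub>R y + e *\<^sub>R x \<in> prob_simplex" if y: "y \<in> prob_simplex" for y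
  proof (intro exI conjI)
    show "1 + m > 1" using m(1) by simp
    have "0 \<le> ((1 - (1 + m)) *\<^sub>R y + (1 + m) *\<^sub>R x) $ i" for i
    proof -
      have "y $ i \<le> (\<Sum>k\<in>UNIV. y $ k)"
        using y by (intro member_le_sum) (auto simp: prob_simplex_def)
      then have "y $ i \<le> 1"
        using y by (simp add: prob_simplex_def)
      then have "m * y $ i \<le> m * 1"
        using m(1) by (intro mult_left_mono) auto
      moreover have "0 \<le> m * x $ i"
        using m(1) pos[of i] by simp
      ultimately show ?thesis
        using m(2)[of i] by (simp add: algebra_simps)
    qed
    moreover have "(\<Sum>i\<in>UNIV. ((1 - (1 + m)) *\<^sub>R y + (1 + m) *\<^sub>R x) $ i) = 1"
      using x y by (simp add: prob_simplex_def sum_subtractf flip: sum_distrib_left)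
    ultimately show "(1 - (1 + m)) *\<^sub>R y + (1 + m) *\<^sub>R x \<in> prob_simplex"
      unfolding prob_simplex_def by blast
  qed
  then show "x \<in> rel_interior prob_simplex"
    using convex_rel_interior_iff[OF convex_prob_simplex] axis_in_prob_simplex by blast
qed

section \<open>Gradients\<close>

lemma gradient_eqI:
  assumes "GDERIV f x :> D"
  shows "gradient f x = D"
  unfolding gradient_def
proof (rule the_equality)
  fix D' assume "GDERIV f x :> D'"
  then have "(\<lambda>h. h \<bullet> D') = (\<lambda>h. h \<bullet> D)"
    using assms unfolding gderiv_def by (rule has_derivative_unique)
  then have "\<forall>h. h \<bullet> D' = h \<bullet> D"
    by (simp add: fun_eq_iff)
  then show "D' = D"
    by (simp only: vector_eq_ldot)
qed (fact assms)

lemma has_derivative_vec_nth: "((\<lambda>x. x $ i) has_derivative (\<lambda>h. h $ i)) F"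
  by (rule bounded_linear.has_derivative[OF bounded_linear_vec_nth has_derivative_ident])

lemma gradient_neg_entropy:
  assumes "\<And>i. 0 < x $ i"
  shows "gradient neg_entropy x = (\<chi> i. ln (x $ i) + 1)"
proof (rule gradient_eqI)
  have nz: "x $ i \<noteq> 0" for i
    using assms[of i] by simp
  have "(neg_entropy has_derivative (\<lambda>h. \<Sum>i\<in>UNIV. x $ i * (h $ i / x $ i) + h $ i * ln (x $ i)))
      (at x)"
    unfolding neg_entropy_def divide_inverse
    by (auto intro!: derivative_eq_intros has_derivative_vec_nth assms simp: mult.commute)
  then show "GDERIV neg_entropy x :> (\<chi> i. ln (x $ i) + 1)"
    unfolding gderiv_def by (simp add: inner_vec_def nz algebra_simps)
qed

section \<open>The mirror map of the negative entropy\<close>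

definition log_sum_exp :: "real ^ 'n \<Rightarrow> real" where
  "log_sum_exp z = ln (\<Sum>k\<in>UNIV. exp (z $ k))"

definition softmax :: "real ^ 'n \<Rightarrow> real ^ 'n" where
  "softmax z = (\<chi> i. exp (z $ i) / (\<Sum>k\<in>UNIV. exp (z $ k)))"

lemma sum_exp_pos: "0 < (\<Sum>k\<in>UNIV. exp (f k :: real))" for f :: "'n::finite \<Rightarrow> real"
  by (intro sum_pos) auto

lemma softmax_pos: "0 < softmax z $ i"
  by (simp add: softmax_def sum_exp_pos)

lemma softmax_in_prob_simplex: "softmax z \<in> prob_simplex"
proof -
  have "(\<Sum>i\<in>UNIV. softmax z $ i) = 1"
    using sum_exp_pos[of "($) z"] by (simp add: softmax_def flip: sum_divide_distrib)
  then show ?thesis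
    by (simp add: prob_simplex_def order_less_imp_le[OF softmax_pos])
qed

lemma ln_softmax: "ln (softmax z $ i) = z $ i - log_sum_exp z"
proof -
  have "(\<Sum>k\<in>UNIV. exp (z $ k)) \<noteq> 0"
    using sum_exp_pos[of "($) z"] by simp
  then show ?thesis
    by (simp add: softmax_def log_sum_exp_def ln_div)
qed

text \<open>
  With \<open>p = softmax z\<close>, the difference of the two sides is minus the relative entropy,
  \<open>\<Sum> x\<^sub>i (ln p\<^sub>i - ln x\<^sub>i)\<close>. Where \<open>x\<^sub>i > 0\<close>, the bound \<open>ln u \<le> u - 1\<close> at \<open>u = p\<^sub>i / x\<^sub>i\<close> shows that
  the summand is at most \<open>p\<^sub>i - x\<^sub>i\<close>; where \<open>x\<^sub>i = 0\<close> this is clear. These bounds add up to zero.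
\<close>

lemma gibbs_inequality:
  assumes x: "x \<in> prob_simplex"
  shows "z \<bullet> x - neg_entropy x \<le> log_sum_exp z"
proof -
  let ?p = "softmax z" and ?L = "log_sum_exp z"
  have term_le: "x $ i * (z $ i - ln (x $ i) - ?L) \<le> ?p $ i - x $ i" for i
  proof (cases "x $ i = 0")
    case True
    then show ?thesis using softmax_pos[of z i] by simp
  next
    case False
    then have xi: "0 < x $ i"
      using x by (simp add: prob_simplex_def order.not_eq_order_implies_strict)
    have "z $ i - ln (x $ i) - ?L = ln (?p $ i / x $ i)"
      using xi softmax_pos[of z i] by (simp add: ln_div ln_softmax)
    also have "\<dots> \<le> ?p $ i / x $ i - 1"
      using xi by (intro ln_le_minus_one) (simp add: softmax_pos)
    finally have "x $ i * (z $ i - ln (x $ i) - ?L) \<le> x $ i * (?p $ i / x $ i - 1)"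
      using xi by simp
    also have "\<dots> = ?p $ i - x $ i"
      using xi by (simp add: field_simps)
    finally show ?thesis .
  qed
  have sum1: "(\<Sum>i\<in>UNIV. x $ i) = 1" "(\<Sum>i\<in>UNIV. ?p $ i) = 1"
    using x softmax_in_prob_simplex[of z] by (simp_all add: prob_simplex_def)
  have "z \<bullet> x - neg_entropy x - ?L = (\<Sum>i\<in>UNIV. z $ i * x $ i - x $ i * ln (x $ i)) - ?L * (\<Sum>i\<in>UNIV. x $ i)"
    by (simp add: inner_vec_def neg_entropy_def sum_subtractf sum1)
  also have "\<dots> = (\<Sum>i\<in>UNIV. x $ i * (z $ i - ln (x $ i) - ?L))"
    unfolding sum_distrib_left sum_subtractf[symmetric] by (simp add: algebra_simps)
  also have "\<dots> \<le> (\<Sum>i\<in>UNIV. ?p $ i - x $ i)"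
    by (intro sum_mono term_le)
  also have "\<dots> = 0"
    by (simp add: sum_subtractf sum1)
  finally show ?thesis by simp
qed

lemma gibbs_equality: "z \<bullet> softmax z - neg_entropy (softmax z) = log_sum_exp z"
proof -
  let ?p = "softmax z"
  have "z \<bullet> ?p - neg_entropy ?p = (\<Sum>i\<in>UNIV. z $ i * ?p $ i - ?p $ i * (z $ i - log_sum_exp z))"
    by (simp add: inner_vec_def neg_entropy_def ln_softmax sum_subtractf)
  also have "\<dots> = log_sum_exp z * (\<Sum>i\<in>UNIV. ?p $ i)"
    by (simp add: sum_distrib_left algebra_simps)
  finally show ?thesis
    using softmax_in_prob_simplex[of z] by (simp add: prob_simplex_def)
qed

lemma conjugate_neg_entropy: "conjugate_on prob_simplex neg_entropy z = log_sum_exp z"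
  unfolding conjugate_on_def
proof (rule cSup_eq_maximum)
  show "log_sum_exp z \<in> (\<lambda>x. z \<bullet> x - neg_entropy x) ` prob_simplex"
    unfolding gibbs_equality[of z, symmetric] by (intro imageI softmax_in_prob_simplex)
next
  fix c assume "c \<in> (\<lambda>x. z \<bullet> x - neg_entropy x) ` prob_simplex"
  then show "c \<le> log_sum_exp z"
    by (elim imageE) (simp only: gibbs_inequality)
qed

lemma mirror_map_eq_softmax: "mirror_map = softmax"
proof
  fix z :: "real ^ 'n"
  have "(log_sum_exp has_derivative
      (\<lambda>h. (\<Sum>k\<in>UNIV. exp (z $ k) * h $ k) / (\<Sum>k\<in>UNIV. exp (z $ k)))) (at z)"
    unfolding log_sum_exp_def
    by (auto intro!: derivative_eq_intros has_derivative_vec_nth simp: sum_exp_pos divide_inverse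
        mult.commute)
  then have "GDERIV log_sum_exp z :> softmax z"
    unfolding gderiv_def
    by (simp add: inner_vec_def softmax_def sum_divide_distrib mult.commute)
  then show "mirror_map z = softmax z"
    unfolding mirror_map_def conjugate_neg_entropy[abs_def] by (rule gradient_eqI)
qed

lemma mirror_map_in_rel_interior: "mirror_map z \<in> rel_interior prob_simplex"
  by (simp add: mirror_map_eq_softmax rel_interior_prob_simplex softmax_in_prob_simplex softmax_pos)

text \<open>
  A mirror step is a multiplicative-weights update: the summand \<open>1\<close> of the entropy gradient
  contributes a common factor \<open>e\<close>, which the normalisation removes.
\<close>

lemma mirror_step_eq_simplex_plus:
  assumes "\<And>i. 0 < x $ i"
  shows "mirror_map (gradient neg_entropy x + v) = x \<oplus> exp_vec v"
proof -
  have e: "exp ((gradient neg_entropy x + v) $ k) = exp 1 * (x $ k * exp (v $ k))" for k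
    using assms by (simp add: gradient_neg_entropy exp_add)
  have "mirror_map (gradient neg_entropy x + v) $ i = (x \<oplus> exp_vec v) $ i" for i
    unfolding mirror_map_eq_softmax softmax_def e
    by (simp add: simplex_plus_def exp_vec_def flip: sum_distrib_left)
  then show ?thesis
    by (simp add: vec_eq_iff)
qed

section \<open>From the dual update to the BNN dynamics\<close>

text \<open>
  In dual coordinates a mirror step by \<open>v\<close> is a translation by \<open>v\<close>, except for the normalising
  constant, which is the same in every coordinate.
\<close>

lemma dual_displacement_simplex_plus:
  assumes pos: "\<And>i. 0 < x $ i"
  obtains c where "\<And>k. gradient neg_entropy (x \<oplus> exp_vec v) $ k - gradient neg_entropy x $ k
    = v $ k - c"
proof
  fix k
  let ?Z = "\<Sum>j\<in>UNIV. x $ j * exp (v $ j)"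
  have Z: "0 < ?Z"
    using pos by (intro sum_pos) auto
  have "0 < (x \<oplus> exp_vec v) $ j" for j
    using pos Z by (simp add: simplex_plus_def exp_vec_def)
  then show "gradient neg_entropy (x \<oplus> exp_vec v) $ k - gradient neg_entropy x $ k = v $ k - ln ?Z"
    using pos Z less_imp_neq[OF Z] less_imp_neq[OF pos[of k]]
    by (simp add: gradient_neg_entropy simplex_plus_def exp_vec_def ln_div ln_mult)
qed

text \<open>Moving the dual variable is a replicator equation for the primal one, with the dual
  velocity as payoff.\<close>

lemma softmax_curve_derivative:
  assumes z: "(z has_vector_derivative v) (at t within J)"
  shows "((\<lambda>s. softmax (z s) $ i) has_real_derivative
    softmax (z t) $ i * (v $ i - (\<Sum>k\<in>UNIV. softmax (z t) $ k * v $ k))) (at t within J)"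
proof -
  have zk: "((\<lambda>s. z s $ k) has_real_derivative v $ k) (at t within J)" for k
    using bounded_linear.has_vector_derivative[OF bounded_linear_vec_nth z]
    by (simp add: has_real_derivative_iff_has_vector_derivative)
  have exp_zk: "((\<lambda>s. exp (z s $ k)) has_real_derivative exp (z t $ k) * v $ k) (at t within J)" for k
    by (rule derivative_eq_intros zk refl)+
  define Z where "Z = (\<Sum>k\<in>UNIV. exp (z t $ k))"
  define V where "V = (\<Sum>k\<in>UNIV. exp (z t $ k) * v $ k)"
  have Z: "Z \<noteq> 0"
    using sum_exp_pos[of "\<lambda>k. z t $ k"] by (simp add: Z_def)
  have "((\<lambda>s. exp (z s $ i) / (\<Sum>k\<in>UNIV. exp (z s $ k))) has_real_derivative
      (exp (z t $ i) * v $ i * Z - exp (z t $ i) * V) / (Z * Z)) (at t within J)"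
    using Z unfolding Z_def V_def
    by (intro DERIV_divide DERIV_sum exp_zk)
  moreover have "(\<Sum>k\<in>UNIV. softmax (z t) $ k * v $ k) = V / Z"
    by (simp add: softmax_def V_def Z_def sum_divide_distrib)
  then have "(exp (z t $ i) * v $ i * Z - exp (z t $ i) * V) / (Z * Z)
      = softmax (z t) $ i * (v $ i - (\<Sum>k\<in>UNIV. softmax (z t) $ k * v $ k))"
    using Z by (simp add: softmax_def field_simps flip: Z_def)
  ultimately show ?thesis
    by (simp add: softmax_def)
qed

text \<open>The replicator field is blind to multiples of the all-ones vector, because the coordinates
  of \<open>x\<close> add up to one; the weights \<open>x\<^sub>k\<close> undo the normalisation of the excess.\<close>

lemma replicator_normalized_excess:
  assumes x: "x \<in> prob_simplex" and pos: "\<And>i. 0 < x $ i"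
    and w: "\<And>k. w $ k = normalized_excess F x $ k - c"
  shows "x $ i * (w $ i - (\<Sum>k\<in>UNIV. x $ k * w $ k)) = bnn_field F x $ i"
proof -
  have nz: "x $ k \<noteq> 0" for k
    using pos[of k] by simp
  have xw: "x $ k * w $ k = pos_part_vec (- Fhat F x) $ k - c * x $ k" for k
    using nz[of k] by (simp add: w normalized_excess_def field_simps)
  have "(\<Sum>k\<in>UNIV. x $ k * w $ k) = (\<Sum>k\<in>UNIV. pos_part_vec (- Fhat F x) $ k) - c"
    using x by (simp add: xw sum_subtractf prob_simplex_def flip: sum_distrib_left)
  then have "x $ i * (w $ i - (\<Sum>k\<in>UNIV. x $ k * w $ k))
      = x $ i * w $ i - x $ i * ((\<Sum>k\<in>UNIV. pos_part_vec (- Fhat F x) $ k) - c)"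
    by (simp only: right_diff_distrib)
  also have "\<dots> = bnn_field F x $ i"
    unfolding xw by (simp add: bnn_field_def right_diff_distrib)
  finally show ?thesis .
qed

theorem lemma2:
  fixes F S T :: "real ^ 'n \<Rightarrow> real ^ 'n"
    and \<eta> \<alpha> :: real
  assumes lipschitz: "\<exists>L. L-lipschitz_on prob_simplex F"
    and pseudo_monotone: "pseudo_monotone_on prob_simplex F"
    and VI_solution: "\<exists>xs\<in>prob_simplex. \<forall>x\<in>prob_simplex. F xs \<bullet> (x - xs) \<ge> 0"
    and eta: "\<eta> > 0"
    and alpha: "\<alpha> = 1 / \<eta>"
    and S: "S = gradient neg_entropy"
    and T: "\<And>x. x \<in> rel_interior prob_simplex \<Longrightarrow>
              T x = mirror_map (gradient neg_entropy x + \<eta> *\<^sub>R normalized_excess F x)"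
  shows "(\<forall>(J :: real set) (z :: real \<Rightarrow> real ^ 'n) (x :: real \<Rightarrow> real ^ 'n).
            is_interval J \<longrightarrow>
            (\<forall>t\<in>J. x t = mirror_map (z t)) \<longrightarrow>
            (\<forall>t\<in>J. (z has_vector_derivative \<alpha> *\<^sub>R (S (T (x t)) - S (x t))) (at t within J)) \<longrightarrow>
            (\<forall>t\<in>J. \<forall>i. ((\<lambda>s. x s $ i) has_real_derivative bnn_field F (x t) $ i) (at t within J)))
       \<and> (\<forall>x\<in>rel_interior prob_simplex.
            T x = x \<oplus> exp_vec (\<eta> *\<^sub>R normalized_excess F x)
            \<and> T x \<in> rel_interior prob_simplex)"
proof (intro conjI ballI allI impI)
  fix x :: "real ^ 'n"
  assume x: "x \<in> rel_interior prob_simplex"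
  then show "T x = x \<oplus> exp_vec (\<eta> *\<^sub>R normalized_excess F x)"
    unfolding T[OF x] by (intro mirror_step_eq_simplex_plus) (simp add: rel_interior_prob_simplex)
  show "T x \<in> rel_interior prob_simplex"
    using T[OF x] mirror_map_in_rel_interior by simp
next
  fix J :: "real set" and z x :: "real \<Rightarrow> real ^ 'n" and t :: real and i :: 'n
  assume xz: "\<forall>t\<in>J. x t = mirror_map (z t)"
    and z: "\<forall>t\<in>J. (z has_vector_derivative \<alpha> *\<^sub>R (S (T (x t)) - S (x t))) (at t within J)"
    and t: "t \<in> J"
  let ?w = "\<alpha> *\<^sub>R (S (T (x t)) - S (x t))"
  have xt: "x t \<in> rel_interior prob_simplex"
    using xz t mirror_map_in_rel_interior by simp
  then have mem: "x t \<in> prob_simplex" and pos: "\<And>k. 0 < x t $ k"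
    by (simp_all add: rel_interior_prob_simplex)
  obtain c where c: "\<And>k. (S (T (x t)) - S (x t)) $ k = \<eta> * normalized_excess F (x t) $ k - c"
    using dual_displacement_simplex_plus[OF pos, of "\<eta> *\<^sub>R normalized_excess F (x t)"]
    by (auto simp: S T[OF xt] mirror_step_eq_simplex_plus[OF pos])
  have w: "?w $ k = normalized_excess F (x t) $ k - c / \<eta>" for k
    using c[of k] eta by (simp add: alpha field_simps)
  have "((\<lambda>s. softmax (z s) $ i) has_real_derivative bnn_field F (x t) $ i) (at t within J)"
    using softmax_curve_derivative[OF z[rule_format, OF t], of i]
      replicator_normalized_excess[OF mem pos w, of i] xz t
    by (simp add: mirror_map_eq_softmax)
  then show "((\<lambda>s. x s $ i) has_real_derivative bnn_field F (x t) $ i) (at t within J)"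
    using xz t by (auto simp: mirror_map_eq_softmax intro: has_field_derivative_transform_within[OF _ zero_less_one])
qed

end
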